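(* Let $(\mathcal{S},\mathcal{U})$ be a right modular pair of subsets of $\mathbf{Z}$ such that $0\neq(\mathcal{U}:\mathcal{U})=n\mathbf{Z}$ (with $n>0$) and let $m\in(\mathcal{S}:\mathcal{U})$. View $\bar{\mathcal{U}}$, the image of $\mathcal{U}$ in $\mathbf{Z}/n\mathbf{Z}$, as a subset of $[0,n)$ and write $\bar{\mathcal{U}}=\{i_0,i_1,\dots,i_{t-1}\}$, with $t=|\bar{\mathcal{U}}|$ and $0=i_0<i_1<\dots<i_{t-1}<n$. The following assertions hold: (1) $\delta_{(\mathcal{S},m)}=m+\delta_{(\mathcal{U},0)}$. (2) $\delta_{(\mathcal{S},m)}:\mathbf{Z}\to\mathbf{Z}$ maps $tj+k\mapsto m+nj+i_k$, for all $j\in\mathbf{Z}$ and all $k\in[0,t)$. (3) If $\mathcal{U}$ is the translation of an interval, then $\delta_{(\mathcal{U},0)}$ is a pseudomorphism of groups.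
   Context: Intervals are intervals of integers. For a subset $\mathcal{S}\subseteq\mathbf{Z}$ which is neither upper nor lower bounded and $s_0\in\mathcal{S}$, $\delta_{(\mathcal{S},s_0)}:\mathbf{Z}\to\mathbf{Z}$ is the unique strictly increasing map with $\delta_{(\mathcal{S},s_0)}(0)=s_0$ and image $\mathcal{S}$. $(\mathcal{S}:\mathcal{U})=\{m\in\mathbf{Z}:m+\mathcal{U}=\mathcal{S}\}$. $\mathcal{U}\subseteq\mathbf{Z}$ is ring-supporting if $0\in\mathcal{U}$ and whenever $u,v,w,u+v+w\in\mathcal{U}$, $u+v\in\mathcal{U}\iff v+w\in\mathcal{U}$. A pair $(\mathcal{S},\mathcal{U})$ of nonempty subsets of $\mathbf{Z}$ is right modular if $\mathcal{U}$ is ring-supporting and for all $(s,u,v)\in\mathcal{S}\times\mathcal{U}\times\mathcal{U}$ with $s+u+v\in\mathcal{S}$, $s+u\in\mathcal{S}\iff u+v\in\mathcal{U}$. A subset $\mathcal{U}$ with $(\mathcal{U}:\mathcal{U})=n\mathbf{Z}$, $n\geq 2$, is the translation of an interval if $\mathcal{U}=\bigcup_{k\in\mathbf{Z}}[nk,nk+r]$ or $\mathcal{U}=\bigcup_{k\in\mathbf{Z}}[nk-r,nk]$ for some natural number $r\ge 0$ with $2r<n$. A pseudomorphism of groups $\varphi:\mathbf{Z}\to\mathbf{Z}$ is an injective map with $\varphi(0)=0$ such that $\varphi(\sigma+\tau)=\varphi(\sigma)+\varphi(\tau)$ whenever $\varphi(\sigma)+\varphi(\tau)\in\mathrm{Im}(\varphi)$.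 *)

theory Defs
  imports Complex_Main "HOL-Library.Infinite_Set"
begin

text \<open>For \<open>S\<close> neither upper nor lower bounded and \<open>s0 \<in> S\<close>, \<open>delta S s0\<close> is the unique strictly
  increasing map with value \<open>s0\<close> at \<open>0\<close> and image \<open>S\<close> (existence and uniqueness: \<open>delta_ex1\<close>
  below); for any other \<open>S\<close> and \<open>s0\<close> it is unspecified.\<close>

definition delta :: "int set \<Rightarrow> int \<Rightarrow> int \<Rightarrow> int" where
  "delta S s0 = (THE f. strict_mono f \<and> f 0 = s0 \<and> range f = S)"

lemma delta_unique:
  fixes f g :: "int \<Rightarrow> int"
  assumes f: "strict_mono f" and g: "strict_mono g" and 0: "f 0 = g 0" and r: "range f = range g"
  shows "f = g"
proof -
  have step: "f (x + 1) = g (x + 1) \<longleftrightarrow> f x = g x" for x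
  proof -
    have aux: "a (x + 1) \<le> b (x + 1)" if h: "strict_mono a" "strict_mono b" "range a = range b" "a x = b x"
      for a b :: "int \<Rightarrow> int"
    proof -
      obtain y where y: "b (x + 1) = a y" using h(3) by (metis rangeE rangeI)
      have "a x < a y" using strict_monoD[OF h(2), of x "x + 1"] h(4) y by simp
      then have "x < y" using strict_mono_less[OF h(1)] by blast
      then show ?thesis using strict_mono_less_eq[OF h(1), of "x + 1" y] y by simp
    qed
    have aux': "b x \<le> a x" if h: "strict_mono a" "strict_mono b" "range a = range b" "a (x + 1) = b (x + 1)"
      for a b :: "int \<Rightarrow> int"
    proof -
      obtain y where y: "b x = a y" using h(3) by (metis rangeE rangeI)
      have "a y < a (x + 1)" using strict_monoD[OF h(2), of x "x + 1"] h(4) y by simp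
      then have "y < x + 1" using strict_mono_less[OF h(1)] by blast
      then show ?thesis using strict_mono_less_eq[OF h(1), of y x] y by simp
    qed
    show ?thesis
      using aux[OF f g r] aux[OF g f r[symmetric]] aux'[OF f g r] aux'[OF g f r[symmetric]] by force
  qed
  have "f x = g x" for x
  proof (induction x rule: int_induct[where k = 0])
    case base then show ?case by (rule 0)
  next
    case (step1 i) then show ?case by (simp add: step)
  next
    case (step2 i) then show ?case using step[of "i - 1"] by simp
  qed
  then show ?thesis by blast
qed

lemma delta_ex1:
  fixes S :: "int set"
  assumes a: "\<not> bdd_above S" and b: "\<not> bdd_below S" and s: "s0 \<in> S"
  shows "\<exists>!f :: int \<Rightarrow> int. strict_mono f \<and> f 0 = s0 \<and> range f = S"
proof -
  define A where "A = {k::nat. s0 + int k \<in> S}"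
  define B where "B = {k::nat. s0 - int k \<in> S}"
  have infA: "infinite A" unfolding infinite_nat_iff_unbounded
  proof
    fix m :: nat
    obtain y where "y \<in> S" "y > s0 + int m" using a by (meson bdd_aboveI not_le)
    then have "m < nat (y - s0) \<and> nat (y - s0) \<in> A" by (auto simp: A_def)
    then show "\<exists>n>m. n \<in> A" by blast
  qed
  have infB: "infinite B" unfolding infinite_nat_iff_unbounded
  proof
    fix m :: nat
    obtain y where "y \<in> S" "y < s0 - int m" using b by (meson bdd_belowI not_le)
    then have "m < nat (s0 - y) \<and> nat (s0 - y) \<in> B" by (auto simp: B_def)
    then show "\<exists>n>m. n \<in> B" by blast
  qed
  have A0: "enumerate A 0 = 0" and B0: "enumerate B 0 = 0"
    using s by (auto simp: enumerate_0 A_def B_def intro: Least_equality)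
  have mA: "strict_mono (enumerate A)" and mB: "strict_mono (enumerate B)"
    using infA infB by (auto intro: strict_mono_enumerate)
  define f where "f k = (if k \<ge> 0 then s0 + int (enumerate A (nat k)) else s0 - int (enumerate B (nat (- k))))" for k
  have mono: "strict_mono f"
  proof (rule strict_monoI)
    fix x y :: int assume "x < y"
    have neg: "enumerate B (nat (- x)) > 0" if "x < 0"
      using strict_monoD[OF mB, of 0 "nat (- x)"] that B0 by simp
    consider "0 \<le> x" | "x < 0" "0 \<le> y" | "y < 0" by linarith
    then show "f x < f y"
    proof cases
      case 1 then show ?thesis using \<open>x < y\<close> strict_monoD[OF mA, of "nat x" "nat y"] by (simp add: f_def)
    next
      case 2 then show ?thesis using neg by (simp add: f_def)
    next
      case 3 then show ?thesis using \<open>x < y\<close> strict_monoD[OF mB, of "nat (- y)" "nat (- x)"] by (simp add: f_def)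
    qed
  qed
  have range: "range f = S"
  proof
    show "range f \<subseteq> S"
      using enumerate_in_set[OF infA] enumerate_in_set[OF infB] by (auto simp: f_def A_def B_def)
    show "S \<subseteq> range f"
    proof
      fix y assume y: "y \<in> S"
      show "y \<in> range f"
      proof (cases "y \<ge> s0")
        case True
        then have "nat (y - s0) \<in> A" using y by (simp add: A_def)
        then obtain k where "enumerate A k = nat (y - s0)" using range_enumerate[OF infA] by (metis rangeE)
        then have "f (int k) = y" using True by (simp add: f_def)
        then show ?thesis by blast
      next
        case False
        then have "nat (s0 - y) \<in> B" using y by (simp add: B_def)
        then obtain k where k: "enumerate B k = nat (s0 - y)" using range_enumerate[OF infB] by (metis rangeE)
        then have "k \<noteq> 0" using B0 False by (metis diff_gt_0_iff_gt not_le zero_less_nat_eq less_irrefl)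
        then have "f (- int k) = y" using False k by (simp add: f_def)
        then show ?thesis by blast
      qed
    qed
  qed
  have f0: "f 0 = s0" by (simp add: f_def A0)
  show ?thesis
  proof (rule ex1I[of _ f])
    show "strict_mono f \<and> f 0 = s0 \<and> range f = S" using mono f0 range by blast
  next
    fix g :: "int \<Rightarrow> int" assume "strict_mono g \<and> g 0 = s0 \<and> range g = S"
    then show "g = f" using mono f0 range by (intro delta_unique) simp_all
  qed
qed

definition colon :: "int set \<Rightarrow> int set \<Rightarrow> int set" where
  "colon S U = {m. (+) m ` U = S}"

definition ring_supporting :: "int set \<Rightarrow> bool" where
  "ring_supporting U \<longleftrightarrow> 0 \<in> U \<and>
     (\<forall>u v w. u \<in> U \<and> v \<in> U \<and> w \<in> U \<and> u + v + w \<in> U \<longrightarrow> (u + v \<in> U \<longleftrightarrow> v + w \<in> U))"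

definition right_modular :: "int set \<Rightarrow> int set \<Rightarrow> bool" where
  "right_modular S U \<longleftrightarrow> S \<noteq> {} \<and> U \<noteq> {} \<and> ring_supporting U \<and>
     (\<forall>s\<in>S. \<forall>u\<in>U. \<forall>v\<in>U. s + u + v \<in> S \<longrightarrow> (s + u \<in> S \<longleftrightarrow> u + v \<in> U))"

definition translation_of_interval :: "int set \<Rightarrow> bool" where
  "translation_of_interval U \<longleftrightarrow>
     (\<exists>n\<ge>2. colon U U = range (\<lambda>k. n * k) \<and>
       (\<exists>r\<ge>0. 2 * r < n \<and>
         (U = (\<Union>k. {n * k .. n * k + r}) \<or> U = (\<Union>k. {n * k - r .. n * k}))))"

definition pseudomorphism :: "(int \<Rightarrow> int) \<Rightarrow> bool" where
  "pseudomorphism \<phi> \<longleftrightarrow> inj \<phi> \<and> \<phi> 0 = 0 \<and>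
     (\<forall>\<sigma> \<tau>. \<phi> \<sigma> + \<phi> \<tau> \<in> range \<phi> \<longrightarrow> \<phi> (\<sigma> + \<tau>) = \<phi> \<sigma> + \<phi> \<tau>)"

end

theory Submission
  imports Defs
begin

text \<open>A set \<open>U\<close> that is invariant under translation by \<open>n\<close> is enumerated block by block: the
  \<open>j\<close>-th block of \<open>t\<close> integers is mapped onto the elements of \<open>U\<close> in \<open>[nj, n(j+1))\<close>. If the
  residues form the interval \<open>[0, r]\<close> with \<open>2r < n\<close>, then two residues can be added without
  wrapping around modulo \<open>n\<close>, so a sum of two values lies in \<open>U\<close> only if the residues, and hence
  also the positions within the blocks, add up without a carry.\<close>

lemma delta_eqI:
  assumes "strict_mono f" "f 0 = s" "range f = S"
  shows "delta S s = f"
  unfolding delta_def using assms by (intro the_equality) (auto intro!: delta_unique)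

text \<open>For \<open>t > 0\<close> the operations \<open>div\<close> and \<open>mod\<close> round
  down, so also for negative \<open>x\<close> the quotient numbers the block and the remainder, in
  \<open>[0, t)\<close>, is the position inside it.\<close>

definition periodic_enum :: "int \<Rightarrow> nat \<Rightarrow> (nat \<Rightarrow> int) \<Rightarrow> int \<Rightarrow> int" where
  "periodic_enum n t i x = n * (x div int t) + i (nat (x mod int t))"

lemma periodic_enum_block:
  assumes "k < t"
  shows "periodic_enum n t i (int t * j + int k) = n * j + i k"
  using assms by (simp add: periodic_enum_def)

text \<open>Inside a block the growth is that of \<open>i\<close>. Between blocks at least
  \<open>n\<close> is gained, which exceeds every difference of two values of \<open>i\<close>,
  since these lie in \<open>[0, n)\<close>.\<close>

lemma strict_mono_periodic_enum:
  assumes t: "t > 0" and i: "strict_mono_on {..<t} i" and b: "i ` {..<t} \<subseteq> {0..<n}"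
  shows "strict_mono (periodic_enum n t i)"
proof (rule strict_monoI)
  fix x y :: int
  assume xy: "x < y"
  have mem: "nat (z mod int t) \<in> {..<t}" for z
    using t by (simp add: nat_less_iff)
  have bnd: "0 \<le> i (nat (z mod int t))" "i (nat (z mod int t)) < n" for z
    using b mem[of z] by auto
  show "periodic_enum n t i x < periodic_enum n t i y"
  proof (cases "x div int t = y div int t")
    case True
    then have "x mod int t < y mod int t"
      using xy by (metis add_less_cancel_left mult_div_mod_eq)
    then have "nat (x mod int t) < nat (y mod int t)"
      using t by simp (meson le_less_trans of_nat_0_less_iff pos_mod_sign)
    then show ?thesis
      using strict_mono_onD[OF i mem mem] True by (simp add: periodic_enum_def)
  next
    case False
    have "x div int t \<le> y div int t"
      using xy t by (simp add: zdiv_mono1)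
    with False have "x div int t + 1 \<le> y div int t" by simp
    then have "n * (x div int t + 1) \<le> n * (y div int t)"
      using bnd[of x] by (intro mult_left_mono) auto
    then show ?thesis
      using bnd[of x] bnd[of y] by (simp add: periodic_enum_def algebra_simps)
  qed
qed

text \<open>As the values of \<open>i\<close> are reduced modulo \<open>n\<close>, dividing a value
  of the enumeration by \<open>n\<close> recovers its block and its residue. This also yields the
  preimage of a given \<open>u\<close>.\<close>

lemma range_periodic_enum:
  assumes t: "t > 0" and b: "i ` {..<t} \<subseteq> {0..<n}"
  shows "range (periodic_enum n t i) = {u. u mod n \<in> i ` {..<t}}"
proof (intro equalityI subsetI)
  fix u assume "u \<in> range (periodic_enum n t i)"
  then obtain x where x: "u = n * (x div int t) + i (nat (x mod int t))"
    by (auto simp: periodic_enum_def)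
  have mem: "nat (x mod int t) \<in> {..<t}"
    using t by (simp add: nat_less_iff)
  then have "i (nat (x mod int t)) \<in> {0..<n}" using b by blast
  then have "u mod n = i (nat (x mod int t))" using x by simp
  then show "u \<in> {u. u mod n \<in> i ` {..<t}}" using mem by auto
next
  fix u assume "u \<in> {u. u mod n \<in> i ` {..<t}}"
  then obtain k where k: "k < t" "u mod n = i k" by auto
  have "periodic_enum n t i (int t * (u div n) + int k) = u"
    using k by (simp add: periodic_enum_block flip: k(2))
  then show "u \<in> range (periodic_enum n t i)" by (metis rangeI)
qed

text \<open>Congruent integers differ by an element of \<open>colon U U\<close>, and translation by
  it preserves \<open>U\<close>. So \<open>U\<close> gets the form in which the range of a periodic
  enumeration is described.\<close>

lemma periodic_of_colon:
  assumes c: "colon U U = range (\<lambda>k. n * k)"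
  shows "U = {u. u mod n \<in> (\<lambda>u. u mod n) ` U}"
proof (intro equalityI subsetI)
  fix u assume "u \<in> {u. u mod n \<in> (\<lambda>u. u mod n) ` U}"
  then obtain v where v: "v \<in> U" "u mod n = v mod n" by auto
  then obtain k where k: "u = v + n * k" by (metis mod_eqE)
  have "n * k \<in> colon U U" using c by blast
  then have "(+) (n * k) ` U = U" by (simp add: colon_def)
  with v(1) k show "u \<in> U" by (metis add.commute imageI)
qed auto

text \<open>Conjugation by negation reduces the intervals \<open>{n * k - r .. n * k}\<close> to the
  intervals \<open>{n * k .. n * k + r}\<close>.\<close>

lemma pseudomorphism_uminus:
  assumes "pseudomorphism f"
  shows "pseudomorphism (\<lambda>x. - f (- x))"
proof -
  have i: "inj f" and z: "f 0 = 0"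
    and s: "\<And>x y. f x + f y \<in> range f \<Longrightarrow> f (x + y) = f x + f y"
    using assms by (auto simp: pseudomorphism_def)
  have "- f (- (x + y)) = - f (- x) + - f (- y)"
    if "- f (- x) + - f (- y) \<in> range (\<lambda>x. - f (- x))" for x y
  proof -
    from that obtain w where "- f (- x) + - f (- y) = - f (- w)" by (rule rangeE)
    then have "f (- x) + f (- y) = f (- w)" by simp
    then show ?thesis using s[of "- x" "- y"] by simp
  qed
  moreover have "inj (\<lambda>x. - f (- x))" by (auto intro!: injI dest!: injD[OF i])
  ultimately show ?thesis using z unfolding pseudomorphism_def by simp
qed

lemma pseudomorphism_interval_enum:
  assumes r: "2 * int r < n"
  shows "pseudomorphism (periodic_enum n (Suc r) int)" (is "pseudomorphism ?f")
proof -
  have b: "int ` {..<Suc r} \<subseteq> {0..<n}" using r by auto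
  have m: "strict_mono ?f"
    by (rule strict_mono_periodic_enum) (use b in \<open>auto intro: strict_mono_onI\<close>)
  have "?f (x + y) = ?f x + ?f y" if h: "?f x + ?f y \<in> range ?f" for x y
  proof -
    define j k j' k' where "j = x div int (Suc r)" and "k = nat (x mod int (Suc r))"
      and "j' = y div int (Suc r)" and "k' = nat (y mod int (Suc r))"
    have x: "x = int (Suc r) * j + int k" and y: "y = int (Suc r) * j' + int k'"
      by (simp_all add: j_def k_def j'_def k'_def del: of_nat_Suc)
    have k: "k < Suc r" "k' < Suc r"
      by (simp_all add: k_def k'_def nat_less_iff del: of_nat_Suc)
    have fx: "?f x = n * j + int k" and fy: "?f y = n * j' + int k'"
      unfolding x y using k by (simp_all only: periodic_enum_block)
    have "?f x + ?f y = n * (j + j') + int (k + k')"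
      by (simp add: fx fy algebra_simps)
    moreover have "(?f x + ?f y) mod n \<in> int ` {..<Suc r}"
      using h b by (simp add: range_periodic_enum)
    \<comment> \<open>Since \<open>k + k'\<close> is at most \<open>2 * r < n\<close>, it is its own
      residue modulo \<open>n\<close>, and the residues in the range are at most
      \<open>r\<close>.\<close>
    ultimately have s: "k + k' < Suc r"
      using k r by auto
    have "x + y = int (Suc r) * (j + j') + int (k + k')"
      by (simp add: x y algebra_simps)
    then have "?f (x + y) = n * (j + j') + int (k + k')"
      using s by (simp only: periodic_enum_block)
    then show ?thesis by (simp add: fx fy algebra_simps)
  qed
  moreover have "inj ?f" using m by (rule strict_mono_imp_inj_on)
  moreover have "?f 0 = 0" by (simp add: periodic_enum_def)
  ultimately show ?thesis by (auto simp: pseudomorphism_def)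
qed

text \<open>The offset of \<open>u\<close> from the left end of its interval lies in
  \<open>[0, n)\<close> and is therefore the residue of \<open>u\<close>.\<close>

lemma interval_union_mod:
  fixes n r :: int
  assumes "0 \<le> r" "r < n"
  shows "(\<Union>k. {n * k .. n * k + r}) = {u. u mod n \<in> {0..r}}"
proof (intro equalityI subsetI)
  fix u assume "u \<in> (\<Union>k. {n * k .. n * k + r})"
  then obtain k where k: "n * k \<le> u" "u \<le> n * k + r" by auto
  have "u = n * k + (u - n * k)" by simp
  then have "u mod n = (u - n * k) mod n" by (metis mod_mult_self4)
  also have "\<dots> = u - n * k" using k assms by (intro mod_pos_pos_trivial) auto
  finally show "u \<in> {u. u mod n \<in> {0..r}}" using k by simp
next
  fix u assume "u \<in> {u. u mod n \<in> {0..r}}"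
  then have "u \<in> {n * (u div n) .. n * (u div n) + r}"
    using mult_div_mod_eq[of n u] unfolding atLeastAtMost_iff mem_Collect_eq by linarith
  then show "u \<in> (\<Union>k. {n * k .. n * k + r})" by blast
qed

lemma pseudomorphism_delta_interval:
  assumes "translation_of_interval U"
  shows "pseudomorphism (delta U 0)"
proof -
  obtain n r where r0: "0 \<le> r" and r: "2 * r < n"
    and U: "U = (\<Union>k. {n * k .. n * k + r}) \<or> U = (\<Union>k. {n * k - r .. n * k})"
    using assms unfolding translation_of_interval_def by blast
  define f where "f = periodic_enum n (Suc (nat r)) int"
  have b: "int ` {..<Suc (nat r)} \<subseteq> {0..<n}" using r r0 by auto
  have img: "int ` {..<Suc (nat r)} = {0..r}"
    using r0 by (simp add: lessThan_Suc_atMost image_int_atLeastAtMost flip: atLeast0AtMost)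
  have mono: "strict_mono f"
    unfolding f_def
    by (rule strict_mono_periodic_enum) (use b in \<open>auto intro: strict_mono_onI\<close>)
  have f0: "f 0 = 0" by (simp add: f_def periodic_enum_def)
  have ran: "range f = (\<Union>k. {n * k .. n * k + r})"
    unfolding f_def using b r r0 by (simp only: range_periodic_enum img interval_union_mod)
  have psm: "pseudomorphism f"
    unfolding f_def using r r0 by (intro pseudomorphism_interval_enum) simp
  from U show ?thesis
  proof
    assume "U = (\<Union>k. {n * k .. n * k + r})"
    then have "delta U 0 = f" using mono f0 ran by (intro delta_eqI) auto
    then show ?thesis using psm by simp
  next
    assume U: "U = (\<Union>k. {n * k - r .. n * k})"
    \<comment> \<open>Negation turns the \<open>k\<close>-th interval into the one ending at
      \<open>n * (- k)\<close>; replacing \<open>k\<close> by \<open>- k\<close> then gives the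
      union in the second form.\<close>
    have "range (\<lambda>x. - f (- x)) = uminus ` f ` range uminus"
      by (simp only: image_image)
    also have "\<dots> = (\<Union>k. uminus ` {n * k .. n * k + r})"
      by (simp add: ran image_UN)
    also have "\<dots> = (\<Union>k. {n * (- k) - r .. n * (- k)})"
      by simp
    also have "\<dots> = (\<Union>k\<in>range uminus. {n * k - r .. n * k})"
      by (simp only: image_image)
    also have "\<dots> = U"
      using U by simp
    finally have "delta U 0 = (\<lambda>x. - f (- x))"
      using mono f0 by (intro delta_eqI) (auto simp: strict_mono_def)
    then show ?thesis using pseudomorphism_uminus[OF psm] by simp
  qed
qed

theorem lemma4p9:
  fixes S U :: "int set" and n m :: int and t :: nat and i :: "nat \<Rightarrow> int"
  assumes "right_modular S U"
    and "colon U U \<noteq> {0}"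
    and "n > 0" and "colon U U = range (\<lambda>k. n * k)"
    and "m \<in> colon S U"
    and "t = card ((\<lambda>u. u mod n) ` U)"
    and "(\<lambda>u. u mod n) ` U = i ` {..<t}"
    and "i 0 = 0" and "strict_mono_on {..<t} i"
  shows "delta S m = (\<lambda>x. m + delta U 0 x)
    \<and> (\<forall>j::int. \<forall>k<t. delta S m (int t * j + int k) = m + n * j + i k)
    \<and> (translation_of_interval U \<longrightarrow> pseudomorphism (delta U 0))"
proof -
  define f where "f = periodic_enum n t i"
  have "U \<noteq> {}" using assms(1) by (simp add: right_modular_def)
  then have t: "t > 0" using assms(7) by (cases t) auto
  have b: "i ` {..<t} \<subseteq> {0..<n}"
    using assms(3) by (auto simp flip: assms(7))
  have mono: "strict_mono f"
    unfolding f_def using t assms(9) b by (rule strict_mono_periodic_enum)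
  have f0: "f 0 = 0" by (simp add: f_def periodic_enum_def assms(8))
  have ran: "range f = U"
    \<comment> \<open>Both sets consist of the integers whose residue modulo \<open>n\<close> occurs
      among the residues of \<open>U\<close>.\<close>
    using range_periodic_enum[OF t b] periodic_of_colon[OF assms(4)]
    by (simp add: f_def assms(7))
  have dU: "delta U 0 = f" using mono f0 ran by (rule delta_eqI)
  \<comment> \<open>As \<open>S\<close> is the translate of \<open>U\<close> by \<open>m\<close>,
    the shifted enumeration has image \<open>S\<close> and value \<open>m\<close> at 0, so
    uniqueness identifies it with \<open>delta S m\<close>.\<close>
  have "range (\<lambda>x. m + f x) = S"
    using assms(5) by (simp add: colon_def image_image flip: ran)
  then have dS: "delta S m = (\<lambda>x. m + f x)"
    using mono f0 by (intro delta_eqI) (auto simp: strict_mono_def)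
  show ?thesis
    using pseudomorphism_delta_interval[of U]
    by (simp add: dS dU f_def periodic_enum_block)
qed

end
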